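(* For every (possibly partial) Boolean function $f:\{0,1\}^n\times\{0,1\}^n\to\{0,1\}$ we have $GH(f)\geq N(f)-1$.
   Context: Garden-hose model: Alice holds $x$, Bob holds $y$. A garden-hose protocol of size $s$ consists of a set $V$ of $s$ vertices (pipes) and an extra vertex $t$ (the tap), together with an assignment of a matching $E_A(x)$ on $V\cup\{t\}$ to every input $x$ of Alice and a matching $E_B(y)$ on $V$ to every input $y$ of Bob. In the graph $(V\cup\{t\},E_A(x)\cup E_B(y))$ every vertex has degree at most 2, so there is a unique maximal path starting at $t$ (of length 0 if $t$ is unmatched); the output on $(x,y)$ is the parity of the number of edges of this path. The protocol computes $f$ if the output equals $f(x,y)$ for every $(x,y)$ on which $f$ is defined. $GH(f)$ is the minimum size of a garden-hose protocol computing $f$. $N(f)$ is the (two-sided) non-deterministic communication complexity: the minimal worst-case communication of a two-player protocol in which Alice and Bob may make non-deterministic guesses and output one of accept, reject, undecided, such that for each $(x,y)$ with $f(x,y)=1$ some guess leads to accept and no guess leads to reject, and for each $(x,y)$ with $f(x,y)=0$ some guess leads to reject and no guess leads to accept. *)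

theory Defs
  imports Main "HOL-Library.Extended_Nat"
begin

definition bits :: "nat \<Rightarrow> bool list set" where
  "bits n = {x. length x = n}"

text \<open>
  A partial Boolean function on \<open>{0,1}\<^sup>n \<times> {0,1}\<^sup>n\<close> is a map
  \<open>f :: bool list \<Rightarrow> bool list \<Rightarrow> bool option\<close>, with \<open>None\<close> where it is undefined; its values
  outside \<open>bits n \<times> bits n\<close> are never consulted.
\<close>

definition matching_on :: "'v set \<Rightarrow> 'v set set \<Rightarrow> bool" where
  "matching_on W M \<longleftrightarrow> (\<forall>e\<in>M. e \<subseteq> W \<and> card e = 2) \<and> pairwise disjnt M"

definition graph_path :: "'v set set \<Rightarrow> 'v list \<Rightarrow> bool" where
  "graph_path E p \<longleftrightarrow>
     p \<noteq> [] \<and> distinct p \<and> (\<forall>i. Suc i < length p \<longrightarrow> {p ! i, p ! Suc i} \<in> E)"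

definition maximal_path_from :: "'v set set \<Rightarrow> 'v \<Rightarrow> 'v list \<Rightarrow> bool" where
  "maximal_path_from E t p \<longleftrightarrow>
     graph_path E p \<and> hd p = t \<and> (\<nexists>v. graph_path E (p @ [v]))"

text \<open>
  Vertices are natural numbers, which is no restriction as the vertex set is finite.
\<close>

record garden_hose =
  pipes :: "nat set"
  tap :: nat
  matchA :: "bool list \<Rightarrow> nat set set"
  matchB :: "bool list \<Rightarrow> nat set set"

definition gh_protocol :: "nat \<Rightarrow> garden_hose \<Rightarrow> bool" where
  "gh_protocol n P \<longleftrightarrow>
     finite (pipes P) \<and> tap P \<notin> pipes P \<and>
     (\<forall>x\<in>bits n. matching_on (insert (tap P) (pipes P)) (matchA P x)) \<and>
     (\<forall>y\<in>bits n. matching_on (pipes P) (matchB P y))"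

definition gh_size :: "garden_hose \<Rightarrow> nat" where
  "gh_size P = card (pipes P)"

definition gh_path :: "garden_hose \<Rightarrow> bool list \<Rightarrow> bool list \<Rightarrow> nat list" where
  "gh_path P x y = (THE p. maximal_path_from (matchA P x \<union> matchB P y) (tap P) p)"

text \<open>
  The path is unique by \<open>maximal_path_from_ex1\<close> below. An edge lying in both matchings is never
  on it, so that it does not matter whether parallel edges are merged.
  A path with \<open>k\<close> vertices has \<open>k - 1\<close> edges.
\<close>

definition gh_output :: "garden_hose \<Rightarrow> bool list \<Rightarrow> bool list \<Rightarrow> bool" where
  "gh_output P x y \<longleftrightarrow> odd (length (gh_path P x y) - 1)"

definition gh_computes ::
    "nat \<Rightarrow> garden_hose \<Rightarrow> (bool list \<Rightarrow> bool list \<Rightarrow> bool option) \<Rightarrow> bool" where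
  "gh_computes n P f \<longleftrightarrow>
     (\<forall>x\<in>bits n. \<forall>y\<in>bits n. \<forall>b. f x y = Some b \<longrightarrow> gh_output P x y = b)"

definition GH :: "nat \<Rightarrow> (bool list \<Rightarrow> bool list \<Rightarrow> bool option) \<Rightarrow> enat" where
  "GH n f = Inf {enat (gh_size P) | P. gh_protocol n P \<and> gh_computes n P f}"

datatype verdict = Accept | Reject | Undecided

text \<open>
  Protocol trees. At an inner node its owner announces one bit, depending on her or his input
  and private guess; the bit \<open>False\<close> leads to the first subtree, \<open>True\<close> to the second.
  The verdict is thus determined by the transcript, so that both players know it.
\<close>

datatype protocol =
    Verdict verdict
  | Alice "bool list \<Rightarrow> bool list \<Rightarrow> bool" protocol protocol
  | Bob "bool list \<Rightarrow> bool list \<Rightarrow> bool" protocol protocol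

text \<open>Arguments: Alice's input and guess, then Bob's input and guess.\<close>

fun verdict_of ::
    "protocol \<Rightarrow> bool list \<Rightarrow> bool list \<Rightarrow> bool list \<Rightarrow> bool list \<Rightarrow> verdict" where
  "verdict_of (Verdict v) x g y h = v"
| "verdict_of (Alice m P Q) x g y h = verdict_of (if m x g then Q else P) x g y h"
| "verdict_of (Bob m P Q) x g y h = verdict_of (if m y h then Q else P) x g y h"

fun bits_sent ::
    "protocol \<Rightarrow> bool list \<Rightarrow> bool list \<Rightarrow> bool list \<Rightarrow> bool list \<Rightarrow> nat" where
  "bits_sent (Verdict v) x g y h = 0"
| "bits_sent (Alice m P Q) x g y h = Suc (bits_sent (if m x g then Q else P) x g y h)"
| "bits_sent (Bob m P Q) x g y h = Suc (bits_sent (if m y h then Q else P) x g y h)"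

text \<open>
  Each player privately guesses a string of length \<open>k\<close>. Guesses are free; only the bits
  exchanged are counted.
\<close>

definition nd_computes ::
    "nat \<Rightarrow> nat \<Rightarrow> protocol \<Rightarrow> (bool list \<Rightarrow> bool list \<Rightarrow> bool option) \<Rightarrow> bool" where
  "nd_computes n k P f \<longleftrightarrow>
     (\<forall>x\<in>bits n. \<forall>y\<in>bits n.
       (f x y = Some True \<longrightarrow>
          (\<exists>g\<in>bits k. \<exists>h\<in>bits k. verdict_of P x g y h = Accept) \<and>
          (\<forall>g\<in>bits k. \<forall>h\<in>bits k. verdict_of P x g y h \<noteq> Reject)) \<and>
       (f x y = Some False \<longrightarrow>
          (\<exists>g\<in>bits k. \<exists>h\<in>bits k. verdict_of P x g y h = Reject) \<and>
          (\<forall>g\<in>bits k. \<forall>h\<in>bits k. verdict_of P x g y h \<noteq> Accept)))"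

definition nd_cost :: "nat \<Rightarrow> nat \<Rightarrow> protocol \<Rightarrow> nat" where
  "nd_cost n k P =
     Max {bits_sent P x g y h | x g y h.
            x \<in> bits n \<and> g \<in> bits k \<and> y \<in> bits n \<and> h \<in> bits k}"

definition N :: "nat \<Rightarrow> (bool list \<Rightarrow> bool list \<Rightarrow> bool option) \<Rightarrow> enat" where
  "N n f = Inf {enat (nd_cost n k P) | k P. nd_computes n k P f}"

lemma matching_on_unique:
  assumes "matching_on W M" "{u, v} \<in> M" "{u, w} \<in> M"
  shows "v = w"
proof -
  have "\<not> disjnt {u, v} {u, w}" by (simp add: disjnt_def)
  then have "{u, v} = {u, w}"
    using assms unfolding matching_on_def by (meson pairwiseD)
  then show ?thesis by (auto simp: doubleton_eq_iff)
qed

lemma graph_path_snoc: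
  assumes "graph_path E q" "length p < length q" "p \<noteq> []"
    and agree: "\<And>i. i < length p \<Longrightarrow> p ! i = q ! i"
  shows "graph_path E (p @ [q ! length p])"
proof -
  have "p = take (length p) q"
    using assms(2) agree by (intro nth_equalityI) auto
  then have eq: "p @ [q ! length p] = take (Suc (length p)) q"
    using assms(2) by (metis take_Suc_conv_app_nth)
  show ?thesis
    unfolding eq using assms(1,2) by (auto simp: graph_path_def)
qed

lemma maximal_path_from_ex1:
  assumes fin: "finite V" and t: "t \<notin> V"
    and A: "matching_on (insert t V) A" and B: "matching_on V B"
  shows "\<exists>!p. maximal_path_from (A \<union> B) t p"
proof -
  let ?E = "A \<union> B"
  have sub: "e \<subseteq> insert t V" if "e \<in> ?E" for e
    using that A B unfolding matching_on_def by blast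
  have tB: "{t, v} \<notin> B" for v
    using t B unfolding matching_on_def by blast
  have agree: "p ! i = q ! i"
    if p: "graph_path ?E p" "hd p = t" and q: "graph_path ?E q" "hd q = t"
      and "i < length p" "i < length q" for p q i
    using that(5,6)
  proof (induction i rule: less_induct)
    case (less i)
    show ?case
    proof (cases i)
      case 0
      then show ?thesis using p q by (simp add: graph_path_def hd_conv_nth)
    next
      case (Suc j)
      have j: "p ! j = q ! j" using less Suc by simp
      have ep: "{p ! j, p ! i} \<in> ?E" and eq: "{p ! j, q ! i} \<in> ?E"
        using p(1) q(1) less.prems Suc j by (auto simp: graph_path_def)
      show ?thesis
      proof (cases j)
        case 0
        then have "p ! j = t" using p by (simp add: graph_path_def hd_conv_nth)
        then show ?thesis using ep eq tB matching_on_unique[OF A] by auto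
      next
        case (Suc l)
        have l: "p ! l = q ! l" using less Suc \<open>i = Suc j\<close> by simp
        have "{p ! l, p ! j} \<in> ?E"
          using p(1) less.prems Suc \<open>i = Suc j\<close> by (auto simp: graph_path_def)
        then have el: "{p ! j, p ! l} \<in> ?E" by (simp add: insert_commute)
        have "p ! i \<noteq> p ! l"
          using p(1) less.prems Suc \<open>i = Suc j\<close> by (simp add: graph_path_def nth_eq_iff_index_eq)
        moreover have "q ! i \<noteq> p ! l"
          unfolding l
          using q(1) less.prems Suc \<open>i = Suc j\<close> by (simp add: graph_path_def nth_eq_iff_index_eq)
        ultimately show ?thesis
          using ep eq el matching_on_unique[OF A] matching_on_unique[OF B] by (metis Un_iff)
      qed
    qed
  qed
  have bound: "length p \<le> card (insert t V)" if "graph_path ?E p" "hd p = t" for p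
  proof -
    have "p ! i \<in> insert t V" if "i < length p" for i
    proof (cases i)
      case 0
      then show ?thesis using \<open>graph_path ?E p\<close> \<open>hd p = t\<close>
        by (simp add: graph_path_def hd_conv_nth)
    next
      case (Suc j)
      then have "{p ! j, p ! i} \<in> ?E" using \<open>graph_path ?E p\<close> that by (simp add: graph_path_def)
      then show ?thesis using sub by blast
    qed
    then have "set p \<subseteq> insert t V" by (metis in_set_conv_nth subsetI)
    moreover have "distinct p" using that by (simp add: graph_path_def)
    ultimately show ?thesis using fin by (metis card_mono distinct_card finite_insert)
  qed
  let ?Q = "\<lambda>p. graph_path ?E p \<and> hd p = t"
  have "?Q [t]" by (simp add: graph_path_def)
  moreover have "\<forall>p. ?Q p \<longrightarrow> length p < Suc (card (insert t V))"
    using bound by (simp add: less_Suc_eq_le)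
  ultimately have "\<exists>p. ?Q p \<and> (\<forall>q. ?Q q \<longrightarrow> length q \<le> length p)"
    by (rule ex_has_greatest_nat)
  then obtain p where p: "graph_path ?E p" "hd p = t"
    and longest: "\<And>q. ?Q q \<Longrightarrow> length q \<le> length p"
    by (elim exE conjE) simp
  have "\<not> graph_path ?E (p @ [v])" for v
    using longest[of "p @ [v]"] p by (auto simp: graph_path_def[of _ p])
  then have ex: "maximal_path_from ?E t p"
    using p by (simp add: maximal_path_from_def)
  have le: "length q \<le> length p"
    if "maximal_path_from ?E t p" "maximal_path_from ?E t q" for p q
  proof (rule ccontr)
    assume less: "\<not> length q \<le> length p"
    have pq: "graph_path ?E p" "hd p = t" "graph_path ?E q" "hd q = t"
      using that by (simp_all add: maximal_path_from_def)
    have "p \<noteq> []" using pq(1) by (simp add: graph_path_def)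
    have "graph_path ?E (p @ [q ! length p])"
    proof (rule graph_path_snoc[OF pq(3) _ \<open>p \<noteq> []\<close>])
      show "length p < length q" using less by simp
      show "p ! i = q ! i" if "i < length p" for i
        using agree[OF pq that] that less by simp
    qed
    then show False using that(1) unfolding maximal_path_from_def by blast
  qed
  show ?thesis
  proof (rule ex1I[where a = p])
    show "maximal_path_from ?E t p" by (rule ex)
  next
    fix q assume q: "maximal_path_from ?E t q"
    have len: "length q = length p" using le[OF ex q] le[OF q ex] by simp
    have pq: "graph_path ?E q" "hd q = t"
      using q by (simp_all add: maximal_path_from_def)
    show "q = p"
    proof (rule nth_equalityI[OF len])
      show "q ! i = p ! i" if "i < length q" for i
        using agree[OF pq p that] that len by simp
    qed
  qed
qed

corollary gh_path_maximal:
  assumes "gh_protocol n P" "x \<in> bits n" "y \<in> bits n"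
  shows "maximal_path_from (matchA P x \<union> matchB P y) (tap P) (gh_path P x y)"
  unfolding gh_path_def
proof (rule theI'[OF maximal_path_from_ex1])
  show "finite (pipes P)" "tap P \<notin> pipes P"
    "matching_on (insert (tap P) (pipes P)) (matchA P x)" "matching_on (pipes P) (matchB P y)"
    using assms by (simp_all add: gh_protocol_def)
qed

end

theory Submission
  imports Defs
begin

text \<open>
  A non-deterministic protocol with one more bit than there are pipes: Alice announces a set \<open>S\<close>
  of pipes, meant to be the set of pipes on the path, and Bob announces whether he agrees.
  The path leaves \<open>t\<close> along \<open>A\<close> and alternates between \<open>A\<close> and \<open>B\<close>, so its length is odd exactly
  if its last vertex is matched by \<open>A\<close>, and positive and even exactly if it is matched by \<open>B\<close>.
  Hence it suffices to check that \<open>S \<union> {t}\<close> is closed under both matchings, and that \<open>A\<close> matches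
  all of \<open>S \<union> {t}\<close> if \<open>\<bar>S\<bar>\<close> is odd, \<open>B\<close> all of \<open>S\<close> if \<open>\<bar>S\<bar>\<close> is even: then the path stays in
  \<open>S \<union> {t}\<close> and its length has the parity of \<open>\<bar>S\<bar>\<close>, although \<open>S\<close> may contain other components.
  Alice always has a set that passes her part of the check, so she need not report failure.
\<close>

section \<open>Local checks on a set of pipes\<close>

definition closed_under :: "'v set set \<Rightarrow> 'v set \<Rightarrow> bool" where
  "closed_under M W \<longleftrightarrow> (\<forall>u\<in>W. \<forall>v. {u, v} \<in> M \<longrightarrow> v \<in> W)"

definition alice_agrees :: "'v \<Rightarrow> 'v set set \<Rightarrow> 'v set \<Rightarrow> bool" where
  "alice_agrees t A S \<longleftrightarrow>
     closed_under A (insert t S) \<and> (odd (card S) \<longrightarrow> insert t S \<subseteq> \<Union>A)"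

definition bob_agrees :: "'v set set \<Rightarrow> 'v set \<Rightarrow> bool" where
  "bob_agrees B S \<longleftrightarrow> closed_under B S \<and> (even (card S) \<longrightarrow> S \<subseteq> \<Union>B)"

lemma matching_on_edge:
  assumes "matching_on W M" "u \<in> \<Union>M"
  obtains v where "{u, v} \<in> M" "v \<noteq> u"
proof -
  obtain e where e: "e \<in> M" "u \<in> e" using assms(2) by blast
  then have "card e = 2" using assms(1) by (simp add: matching_on_def)
  then obtain a b where "e = {a, b}" "a \<noteq> b" by (meson card_2_iff)
  with e that show thesis by (metis insert_commute insertE singletonD)
qed

section \<open>The alternating path from the tap\<close>

locale hose_path =
  fixes V :: "'v set" and t A B p
  assumes tap: "t \<notin> V"
    and A: "matching_on (insert t V) A" and B: "matching_on V B"
    and maximal: "maximal_path_from (A \<union> B) t p"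
begin

definition "L = length p - 1"

lemma path: "graph_path (A \<union> B) p"
  using maximal by (simp add: maximal_path_from_def)

lemma distinct: "distinct p" and length: "length p = Suc L"
  using path by (simp_all add: graph_path_def L_def)

lemma p_0: "p ! 0 = t"
  using maximal by (auto simp: maximal_path_from_def graph_path_def hd_conv_nth)

lemma inj: "i \<le> L \<Longrightarrow> j \<le> L \<Longrightarrow> p ! i = p ! j \<longleftrightarrow> i = j"
  using distinct length by (simp add: nth_eq_iff_index_eq)

lemma t_notin_B: "{t, v} \<notin> B" "{v, t} \<notin> B"
  using tap B by (auto simp: matching_on_def)

lemma edge: "i < L \<Longrightarrow> {p ! i, p ! Suc i} \<in> A \<union> B"
  using path length by (simp add: graph_path_def)

text \<open>No edge of \<open>B\<close> meets \<open>t\<close>, so the first edge is in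
  \<open>A\<close>. If two consecutive edges lay in the same matching, their common vertex would
  have two partners, as the vertices of \<open>p\<close> are distinct.\<close>

lemma alternating: "i < L \<Longrightarrow> {p ! i, p ! Suc i} \<in> (if even i then A else B)"
proof (induction i)
  case 0
  then show ?case using edge[of 0] t_notin_B p_0 by auto
next
  case (Suc i)
  have *: "p ! i \<noteq> p ! Suc (Suc i)" using Suc.prems by (simp add: inj)
  have "{p ! Suc i, p ! i} \<in> (if even i then A else B)"
    using Suc by (simp add: insert_commute)
  with * have "{p ! Suc i, p ! Suc (Suc i)} \<notin> (if even i then A else B)"
    using matching_on_unique[OF A] matching_on_unique[OF B] by (metis (full_types))
  with edge[OF Suc.prems] show ?case by (auto split: if_splits)
qed

lemma forward:
  assumes "i < L"
  shows "even i \<Longrightarrow> {p ! i, p ! Suc i} \<in> A" "odd i \<Longrightarrow> {p ! i, p ! Suc i} \<in> B"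
  using alternating[OF assms] by auto

lemma backward:
  assumes "0 < i" "i \<le> L"
  shows "odd i \<Longrightarrow> {p ! i, p ! (i - 1)} \<in> A" "even i \<Longrightarrow> {p ! i, p ! (i - 1)} \<in> B"
  using alternating[of "i - 1"] assms by (auto simp: insert_commute)

lemma in_set: "v \<in> set p \<longleftrightarrow> (\<exists>i\<le>L. v = p ! i)"
  using length by (auto simp: in_set_conv_nth less_Suc_eq_le)

lemma last_neighbour:
  assumes "{p ! L, v} \<in> A \<union> B"
  shows "v \<in> set p"
proof (rule ccontr)
  assume "v \<notin> set p"
  then have "graph_path (A \<union> B) (p @ [v])"
    using path assms length unfolding graph_path_def
    by (auto simp: nth_append less_Suc_eq)
  then show False using maximal by (simp add: maximal_path_from_def)
qed

lemma closed_A: "closed_under A (set p)"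
  unfolding closed_under_def
proof (intro ballI allI impI)
  fix u v assume "u \<in> set p" and uv: "{u, v} \<in> A"
  then obtain i where i: "i \<le> L" "u = p ! i" by (auto simp: in_set)
  \<comment> \<open>Away from the end, the path itself uses the \<open>A\<close>-edge at
    \<open>p ! i\<close>: forwards for even \<open>i\<close>, backwards for odd \<open>i\<close>.
    Uniqueness of the partner then puts \<open>v\<close> on the path.\<close>
  consider "i = L" | "even i" "i < L" | "odd i" "0 < i" using i by (cases "i = L") (auto intro: odd_pos)
  then show "v \<in> set p"
  proof cases
    case 1
    then show ?thesis using last_neighbour uv i by blast
  next
    case 2
    then have "v = p ! Suc i" using matching_on_unique[OF A] forward uv i by blast
    then show ?thesis using 2 by (auto simp: in_set intro!: exI[of _ "Suc i"])
  next
    case 3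
    then have "v = p ! (i - 1)" using matching_on_unique[OF A] backward uv i by blast
    then show ?thesis using i by (auto simp: in_set intro!: exI[of _ "i - 1"])
  qed
qed

lemma closed_B: "closed_under B (set p)"
  unfolding closed_under_def
proof (intro ballI allI impI)
  fix u v assume "u \<in> set p" and uv: "{u, v} \<in> B"
  then obtain i where i: "i \<le> L" "u = p ! i" by (auto simp: in_set)
  have "i \<noteq> 0" using uv i t_notin_B p_0 by metis
  then consider "i = L" | "odd i" "i < L" | "even i" "0 < i" using i by (cases "i = L") auto
  then show "v \<in> set p"
  proof cases
    case 1
    then show ?thesis using last_neighbour uv i by blast
  next
    case 2
    then have "v = p ! Suc i" using matching_on_unique[OF B] forward uv i by blast
    then show ?thesis using 2 by (auto simp: in_set intro!: exI[of _ "Suc i"])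
  next
    case 3
    then have "v = p ! (i - 1)" using matching_on_unique[OF B] backward uv i by blast
    then show ?thesis using i by (auto simp: in_set intro!: exI[of _ "i - 1"])
  qed
qed

text \<open>Only the last vertex after an even number of edges has no \<open>A\<close>-edge on the
  path.\<close>

lemma matched_A: "i \<le> L \<Longrightarrow> i < L \<or> odd L \<Longrightarrow> p ! i \<in> \<Union>A"
  using forward(1)[of i] backward(1)[of i] odd_pos[of i] by (cases "even i") (auto simp: le_less)

lemma matched_B: "0 < i \<Longrightarrow> i \<le> L \<Longrightarrow> i < L \<or> even L \<Longrightarrow> p ! i \<in> \<Union>B"
  using forward(2)[of i] backward(2)[of i] by (cases "even i") (auto simp: le_less)

text \<open>For even \<open>L\<close>, maximality makes an \<open>A\<close>-partner of the last
  vertex some \<open>p ! j\<close> with \<open>j < L\<close>, whose \<open>A\<close>-edge the path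
  already uses. Then \<open>L\<close> would be \<open>j - 1\<close> or, with \<open>j\<close> even,
  the odd number \<open>Suc j\<close>.\<close>

lemma last_matched_A:
  assumes "p ! L \<in> \<Union>A"
  shows "odd L"
proof
  assume "even L"
  obtain v where v: "{p ! L, v} \<in> A" "v \<noteq> p ! L" using assms by (rule matching_on_edge[OF A])
  then have "v \<in> set p" using last_neighbour by blast
  then obtain j where j: "j < L" "v = p ! j" using v(2) by (auto simp: in_set le_less)
  have jL: "{p ! j, p ! L} \<in> A" using v j by (simp add: insert_commute)
  show False
  proof (cases "even j")
    case True
    then have "p ! L = p ! Suc j" using matching_on_unique[OF A jL] forward j by blast
    then show False using inj[of L "Suc j"] j True \<open>even L\<close> by auto
  next
    case False
    then have "p ! L = p ! (j - 1)"
      using matching_on_unique[OF A jL] backward(1)[of j] j odd_pos by auto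
    moreover have "j - 1 < L" using j by linarith
    ultimately show False using inj[of L "j - 1"] by simp
  qed
qed

lemma last_matched_B:
  assumes "p ! L \<in> \<Union>B"
  shows "even L"
proof (rule ccontr)
  assume "odd L"
  obtain v where v: "{p ! L, v} \<in> B" "v \<noteq> p ! L" using assms by (rule matching_on_edge[OF B])
  then have "v \<in> set p" using last_neighbour by blast
  then obtain j where j: "j < L" "v = p ! j" using v(2) by (auto simp: in_set le_less)
  have jL: "{p ! j, p ! L} \<in> B" using v j by (simp add: insert_commute)
  \<comment> \<open>An even \<open>j\<close> needs a predecessor on the path; the tap has none, but
    no \<open>B\<close>-edge either.\<close>
  have "j \<noteq> 0" using jL t_notin_B p_0 by metis
  show False
  proof (cases "odd j")
    case True
    then have "p ! L = p ! Suc j" using matching_on_unique[OF B jL] forward j by blast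
    then show False using inj[of L "Suc j"] j True \<open>odd L\<close> by auto
  next
    case False
    then have "p ! L = p ! (j - 1)"
      using matching_on_unique[OF B jL] backward(2)[of j] j \<open>j \<noteq> 0\<close> by auto
    moreover have "j - 1 < L" using j by linarith
    ultimately show False using inj[of L "j - 1"] by simp
  qed
qed

lemma t_in_path: "t \<in> set p"
  using in_set p_0 by auto

lemma path_subset: "set p - {t} \<subseteq> V"
proof
  fix v assume v: "v \<in> set p - {t}"
  then obtain i where i: "i \<le> L" "v = p ! i" by (auto simp: in_set)
  with v p_0 have "0 < i" by (cases i) auto
  with i have "{p ! i, p ! (i - 1)} \<in> A \<union> B"
    using backward[of i] by blast
  with i v A B show "v \<in> V" unfolding matching_on_def by blast
qed

text \<open>This is why the parity of the true set of pipes is the output.\<close>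

lemma card_path: "card (set p - {t}) = L"
  using t_in_path distinct_card[OF distinct] length by simp

section \<open>Completeness and soundness of the checks\<close>

lemma alice_agrees_path: "alice_agrees t A (set p - {t})"
proof -
  have "insert t (set p - {t}) = set p" using t_in_path by blast
  moreover have "set p \<subseteq> \<Union>A" if "odd L"
    using matched_A that unfolding subset_iff in_set by blast
  ultimately show ?thesis using closed_A unfolding alice_agrees_def card_path by simp
qed

lemma bob_agrees_path: "bob_agrees B (set p - {t})"
  unfolding bob_agrees_def card_path
proof (intro conjI impI)
  show "closed_under B (set p - {t})"
    using closed_B t_notin_B unfolding closed_under_def by blast
next
  assume "even L"
  show "set p - {t} \<subseteq> \<Union>B"
  proof
    fix v assume v: "v \<in> set p - {t}"
    then obtain i where i: "i \<le> L" "v = p ! i" by (auto simp: in_set)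
    with v p_0 have "0 < i" by (cases i) auto
    then show "v \<in> \<Union>B" using matched_B i \<open>even L\<close> by blast
  qed
qed

text \<open>No edge leaves \<open>insert t S\<close>, so the path ends inside it. The parity of
  \<open>card S\<close> decides which matching must cover the last vertex, and this fixes the parity
  of \<open>L\<close>.\<close>

lemma parity_if_agree:
  assumes a: "alice_agrees t A S" and b: "bob_agrees B S"
  shows "odd L \<longleftrightarrow> odd (card S)"
proof -
  have step: "v \<in> insert t S" if "u \<in> insert t S" "{u, v} \<in> A \<union> B" for u v
    using a b that t_notin_B unfolding alice_agrees_def bob_agrees_def closed_under_def by blast
  have "p ! i \<in> insert t S" if "i \<le> L" for i
    using that
  proof (induction i)
    case 0
    then show ?case by (simp add: p_0)
  next
    case (Suc i)
    then show ?case using step edge[of i] by (meson Suc_le_lessD less_imp_le)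
  qed
  then have last: "p ! L \<in> insert t S" by simp
  show ?thesis
  proof (cases "odd (card S)")
    case True
    then have "p ! L \<in> \<Union>A" using last a unfolding alice_agrees_def by blast
    then show ?thesis using True last_matched_A by blast
  next
    case False
    have "even L"
    \<comment> \<open>Bob's check covers \<open>S\<close> but not the tap, at which the path can end
      only if \<open>L = 0\<close>.\<close>
    proof (cases "L = 0")
      case True
      then show ?thesis by simp
    next
      case L: False
      then have "p ! L \<noteq> t" using inj[of L 0] p_0 by simp
      then have "p ! L \<in> \<Union>B" using last b False unfolding bob_agrees_def by blast
      then show ?thesis by (rule last_matched_B)
    qed
    then show ?thesis using False by blast
  qed
qed

end

text \<open>If Bob's matching is empty, then the path is Alice's edge at the tap, if there is one.\<close>

lemma alice_agrees_ex:
  assumes "finite V" "t \<notin> V" "matching_on (insert t V) A"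
  shows "\<exists>S. S \<subseteq> V \<and> alice_agrees t A S"
proof -
  have B: "matching_on V {}" by (simp add: matching_on_def)
  obtain p where "maximal_path_from (A \<union> {}) t p"
    using maximal_path_from_ex1[OF assms B] by blast
  then interpret hose_path V t A "{}" p
    using assms B by unfold_locales
  show ?thesis using alice_agrees_path path_subset by blast
qed

section \<open>The protocol tree and its cost\<close>

fun announce ::
    "nat list \<Rightarrow> (bool list \<Rightarrow> bool list \<Rightarrow> nat set) \<Rightarrow> (nat set \<Rightarrow> protocol) \<Rightarrow> protocol" where
  "announce [] \<sigma> K = K {}"
| "announce (v # vs) \<sigma> K =
     Alice (\<lambda>x g. v \<in> \<sigma> x g) (announce vs \<sigma> K) (announce vs \<sigma> (\<lambda>S. K (insert v S)))"

text \<open>The set announced so far is stored in the continuation, hence the induction over all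
  \<open>K\<close>. As \<open>K\<close> sees nothing but this set, the subtree that it builds
  depends on the transcript alone.\<close>

lemma verdict_of_announce:
  "verdict_of (announce vs \<sigma> K) x g y h = verdict_of (K (\<sigma> x g \<inter> set vs)) x g y h"
  by (induction vs arbitrary: K) auto

lemma bits_sent_announce:
  "bits_sent (announce vs \<sigma> K) x g y h = length vs + bits_sent (K (\<sigma> x g \<inter> set vs)) x g y h"
  by (induction vs arbitrary: K) auto

lemma nd_cost_constant:
  assumes "\<And>x g y h. bits_sent Q x g y h = c"
  shows "nd_cost n k Q = c"
proof -
  \<comment> \<open>Inputs and guesses exist, so \<open>Max\<close> is not taken over the empty
    set.\<close>
  have "\<exists>xs :: bool list. length xs = m" for m by (rule exI[of _ "replicate m True"]) simp
  then have "{bits_sent Q x g y h | x g y h.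
      x \<in> bits n \<and> g \<in> bits k \<and> y \<in> bits n \<and> h \<in> bits k} = {c}"
    by (auto simp: assms bits_def)
  then show ?thesis unfolding nd_cost_def by simp
qed

context
  fixes P :: garden_hose
begin

definition pipe_list :: "nat list" where
  "pipe_list = sorted_list_of_set (pipes P)"

text \<open>A characteristic vector along \<open>pipe_list\<close>; as \<open>zip\<close> truncates,
  a string of any length yields a set of pipes.\<close>

definition guessed :: "bool list \<Rightarrow> nat set" where
  "guessed g = {v. (v, True) \<in> set (zip pipe_list g)}"

text \<open>The \<open>SOME\<close> default, which \<open>alice_agrees_ex\<close> provides, saves
  the bit that would report a failed guess.\<close>

definition announced :: "bool list \<Rightarrow> bool list \<Rightarrow> nat set" where
  "announced x g =
     (if alice_agrees (tap P) (matchA P x) (guessed g) then guessed g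
      else SOME S. S \<subseteq> pipes P \<and> alice_agrees (tap P) (matchA P x) S)"

text \<open>\<open>Undecided\<close> stands first because the bit \<open>False\<close>, Bob's
  disagreement, leads to the first subtree.\<close>

definition guess_protocol :: protocol where
  "guess_protocol =
     announce pipe_list announced
       (\<lambda>S. Bob (\<lambda>y h. bob_agrees (matchB P y) S) (Verdict Undecided)
              (Verdict (if odd (card S) then Accept else Reject)))"

end

text \<open>One bit for each pipe, and Bob's bit, which is the 1 of the theorem.\<close>

lemma nd_cost_guess_protocol: "nd_cost n k (guess_protocol P) = Suc (gh_size P)"
  by (rule nd_cost_constant)
    (simp add: guess_protocol_def bits_sent_announce pipe_list_def gh_size_def)

section \<open>Correctness of the protocol\<close>

lemma guessed_onto:
  assumes "finite (pipes P)" "S \<subseteq> pipes P"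
  shows "\<exists>g\<in>bits (gh_size P). guessed P g = S"
proof
  let ?g = "map (\<lambda>v. v \<in> S) (pipe_list P)"
  show "?g \<in> bits (gh_size P)" by (simp add: bits_def pipe_list_def gh_size_def)
  have "set (pipe_list P) = pipes P" using assms by (simp add: pipe_list_def)
  then show "guessed P ?g = S"
    using assms(2) by (auto simp: guessed_def zip_map2 zip_same_conv_map)
qed

lemma announced:
  assumes "gh_protocol n P" "x \<in> bits n"
  shows "announced P x g \<subseteq> pipes P" "alice_agrees (tap P) (matchA P x) (announced P x g)"
proof -
  have P: "finite (pipes P)" "tap P \<notin> pipes P"
    "matching_on (insert (tap P) (pipes P)) (matchA P x)"
    using assms by (simp_all add: gh_protocol_def)
  have "guessed P g \<subseteq> pipes P"
    using P(1) by (auto simp: guessed_def pipe_list_def dest: set_zip_leftD)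
  then have "announced P x g \<subseteq> pipes P \<and> alice_agrees (tap P) (matchA P x) (announced P x g)"
    using someI_ex[OF alice_agrees_ex[OF P]] by (simp add: announced_def)
  then show "announced P x g \<subseteq> pipes P"
    "alice_agrees (tap P) (matchA P x) (announced P x g)" by blast+
qed

lemma hose_path_gh_path:
  assumes "gh_protocol n P" "x \<in> bits n" "y \<in> bits n"
  shows "hose_path (pipes P) (tap P) (matchA P x) (matchB P y) (gh_path P x y)"
  using assms gh_path_maximal[OF assms] by unfold_locales (simp_all add: gh_protocol_def)

lemma verdict_guess_protocol:
  assumes "gh_protocol n P" "x \<in> bits n"
  shows "verdict_of (guess_protocol P) x g y h =
    (if bob_agrees (matchB P y) (announced P x g)
     then if odd (card (announced P x g)) then Accept else Reject else Undecided)"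
proof -
  have "announced P x g \<inter> set (pipe_list P) = announced P x g"
    using assms announced(1)[OF assms] by (auto simp: pipe_list_def gh_protocol_def)
  then show ?thesis by (simp add: guess_protocol_def verdict_of_announce)
qed

text \<open>Whatever the guess, the announced set passes Alice's check; so either Bob disagrees and
  the verdict is \<open>Undecided\<close>, or \<open>parity_if_agree\<close> applies.\<close>

lemma verdict_sound:
  assumes "gh_protocol n P" "x \<in> bits n" "y \<in> bits n"
  shows "verdict_of (guess_protocol P) x g y h \<noteq>
    (if gh_output P x y then Reject else Accept)"
proof -
  interpret hose_path "pipes P" "tap P" "matchA P x" "matchB P y" "gh_path P x y"
    by (rule hose_path_gh_path[OF assms])
  show ?thesis
    using parity_if_agree[OF announced(2)[OF assms(1,2)], of g]
    by (simp add: verdict_guess_protocol[OF assms(1,2)] gh_output_def L_def)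
qed

lemma verdict_complete:
  assumes "gh_protocol n P" "x \<in> bits n" "y \<in> bits n"
  shows "\<exists>g\<in>bits (gh_size P). \<forall>h.
    verdict_of (guess_protocol P) x g y h = (if gh_output P x y then Accept else Reject)"
proof -
  interpret hose_path "pipes P" "tap P" "matchA P x" "matchB P y" "gh_path P x y"
    by (rule hose_path_gh_path[OF assms])
  have "finite (pipes P)" using assms by (simp add: gh_protocol_def)
  \<comment> \<open>The right guess encodes the pipes on the path; it passes Alice's check, so the
    default does not replace it.\<close>
  from guessed_onto[OF this path_subset]
  obtain g where g: "g \<in> bits (gh_size P)" "guessed P g = set (gh_path P x y) - {tap P}" by blast
  then have "announced P x g = set (gh_path P x y) - {tap P}"
    using alice_agrees_path by (simp add: announced_def)
  then have "\<forall>h. verdict_of (guess_protocol P) x g y h =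
      (if gh_output P x y then Accept else Reject)"
    using bob_agrees_path card_path
    by (simp add: verdict_guess_protocol[OF assms(1,2)] gh_output_def L_def)
  with g(1) show ?thesis by blast
qed

lemma nd_computes_guess_protocol:
  assumes P: "gh_protocol n P" and f: "gh_computes n P f"
  shows "nd_computes n (gh_size P) (guess_protocol P) f"
  unfolding nd_computes_def
proof (intro ballI)
  fix x y assume xy: "x \<in> bits n" "y \<in> bits n"
  have ne: "\<exists>h. h \<in> bits (gh_size P)"
    by (rule exI[of _ "replicate (gh_size P) True"]) (simp add: bits_def)
  have out: "gh_output P x y = b" if "f x y = Some b" for b
    using f xy that by (simp add: gh_computes_def)
  show "(f x y = Some True \<longrightarrow>
          (\<exists>g\<in>bits (gh_size P). \<exists>h\<in>bits (gh_size P).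
             verdict_of (guess_protocol P) x g y h = Accept) \<and>
          (\<forall>g\<in>bits (gh_size P). \<forall>h\<in>bits (gh_size P).
             verdict_of (guess_protocol P) x g y h \<noteq> Reject)) \<and>
        (f x y = Some False \<longrightarrow>
          (\<exists>g\<in>bits (gh_size P). \<exists>h\<in>bits (gh_size P).
             verdict_of (guess_protocol P) x g y h = Reject) \<and>
          (\<forall>g\<in>bits (gh_size P). \<forall>h\<in>bits (gh_size P).
             verdict_of (guess_protocol P) x g y h \<noteq> Accept))"
  proof (intro conjI impI)
    assume *: "f x y = Some True"
    show "\<exists>g\<in>bits (gh_size P). \<exists>h\<in>bits (gh_size P).
        verdict_of (guess_protocol P) x g y h = Accept"
      using verdict_complete[OF P xy] out[OF *] ne by auto
    show "\<forall>g\<in>bits (gh_size P). \<forall>h\<in>bits (gh_size P).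
        verdict_of (guess_protocol P) x g y h \<noteq> Reject"
      using verdict_sound[OF P xy] out[OF *] by simp
  next
    assume *: "f x y = Some False"
    show "\<exists>g\<in>bits (gh_size P). \<exists>h\<in>bits (gh_size P).
        verdict_of (guess_protocol P) x g y h = Reject"
      using verdict_complete[OF P xy] out[OF *] ne by auto
    show "\<forall>g\<in>bits (gh_size P). \<forall>h\<in>bits (gh_size P).
        verdict_of (guess_protocol P) x g y h \<noteq> Accept"
      using verdict_sound[OF P xy] out[OF *] by simp
  qed
qed

theorem theorem1:
  fixes n :: nat
    and f :: "bool list \<Rightarrow> bool list \<Rightarrow> bool option"
  shows "GH n f \<ge> N n f - 1"
  unfolding GH_def
\<comment> \<open>This also covers an \<open>f\<close> that no garden-hose protocol computes, where
  the infimum is \<infinity>.\<close>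
proof (rule Inf_greatest)
  fix s assume "s \<in> {enat (gh_size P) | P. gh_protocol n P \<and> gh_computes n P f}"
  then obtain P where s: "s = enat (gh_size P)" and P: "gh_protocol n P" "gh_computes n P f"
    by blast
  have "N n f \<le> enat (nd_cost n (gh_size P) (guess_protocol P))"
    unfolding N_def using nd_computes_guess_protocol[OF P] by (blast intro: Inf_lower)
  then have "N n f \<le> eSuc s" by (simp add: nd_cost_guess_protocol s eSuc_enat)
  \<comment> \<open>\<open>N n f\<close> is finite, being at most \<open>eSuc s\<close>, so the
    subtraction is that of natural numbers.\<close>
  then show "N n f - 1 \<le> s"
    by (cases "N n f") (auto simp: s eSuc_enat one_enat_def)
qed

end
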